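(* Let $n$ be a positive integer and $A,B\in W^{n-1,q}(D,\mathbb{B})$ with $q>2$. Every $f\in V^n_{A,B}(D,\mathbb{B})$ has the form $$f=\sum_{k=0}^{n-1}(\widehat z+\widehat{z^*})^k\varphi_k,$$ where $\varphi_k\in H_{A,B}(D,\mathbb{B})$ for every $k$.
   Context: $D$ is the open unit disk in $\mathbb{C}$. For $u=x+iy\in\mathbb{C}$, $u^*=x-iy$. $\mathbb{B}$ denotes the bicomplex numbers: the commutative $\mathbb{C}$-algebra of elements $z_1+jz_2$ with $z_1,z_2\in\mathbb{C}$, $j^2=-1$, $ij=ji$. Bicomplex conjugation is $\overline{z_1+jz_2}=z_1-jz_2$, and $C(\cdot)$ is the operator applying bicomplex conjugation, $C(f)=\overline f$. The bicomplexification of $u=x+iy$ is $\widehat u=x+jy\in\mathbb{B}$; thus $\widehat z+\widehat{z^*}=2x$ for $z=x+iy$. $W^{n-1,q}(D,\mathbb{B})$ is the Sobolev space of $\mathbb{B}$-valued functions on $D$ whose components are in the usual Sobolev space $W^{n-1,q}(D)$ (with $W^{0,q}=L^q$). $\bar\partial=\frac12(\partial_x+j\partial_y)$. $H_{A,B}(D,\mathbb{B})$ is the set of $f:D\to\mathbb{B}$ with $\bar\partial f=Af+B\overline f$. $V^n_{A,B}(D,\mathbb{B})$ is the set of $f:D\to\mathbb{B}$ with $(\bar\partial-A-BC(\cdot))^nf=0$. Derivatives are understood in the weak sense, the iterates $(\bar\partial-A-BC(\cdot))^kf$, $0\le k\le n$, being locally integrable functions obtained successively. *)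

theory Defs
  imports "HOL-Analysis.Analysis"
begin

section \<open>Bicomplex numbers\<close>

text \<open>\<open>Bicomplex z1 z2\<close> stands for $z_1 + j z_2$.\<close>

datatype bicomplex = Bicomplex (bc_fst: complex) (bc_snd: complex)

lemma bicomplex_eq_iff: "u = v \<longleftrightarrow> bc_fst u = bc_fst v \<and> bc_snd u = bc_snd v"
  by (cases u; cases v) auto

instantiation bicomplex :: comm_ring_1
begin

definition zero_bicomplex_def: "0 = Bicomplex 0 0"
definition one_bicomplex_def: "1 = Bicomplex 1 0"
definition plus_bicomplex_def:
  "u + v = Bicomplex (bc_fst u + bc_fst v) (bc_snd u + bc_snd v)"
definition uminus_bicomplex_def: "- u = Bicomplex (- bc_fst u) (- bc_snd u)"
definition minus_bicomplex_def:
  "u - v = Bicomplex (bc_fst u - bc_fst v) (bc_snd u - bc_snd v)"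
definition times_bicomplex_def:
  "u * v = Bicomplex (bc_fst u * bc_fst v - bc_snd u * bc_snd v)
                     (bc_fst u * bc_snd v + bc_snd u * bc_fst v)"

instance
  by standard
    (auto simp: bicomplex_eq_iff zero_bicomplex_def one_bicomplex_def plus_bicomplex_def
      uminus_bicomplex_def minus_bicomplex_def times_bicomplex_def algebra_simps)

end

lemma bicomplex_sel [simp]:
  "bc_fst 0 = 0" "bc_snd 0 = 0" "bc_fst 1 = 1" "bc_snd 1 = 0"
  "bc_fst (u + v) = bc_fst u + bc_fst v" "bc_snd (u + v) = bc_snd u + bc_snd v"
  "bc_fst (- u) = - bc_fst u" "bc_snd (- u) = - bc_snd u"
  "bc_fst (u - v) = bc_fst u - bc_fst v" "bc_snd (u - v) = bc_snd u - bc_snd v"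
  "bc_fst (u * v) = bc_fst u * bc_fst v - bc_snd u * bc_snd v"
  "bc_snd (u * v) = bc_fst u * bc_snd v + bc_snd u * bc_fst v"
  by (simp_all add: zero_bicomplex_def one_bicomplex_def plus_bicomplex_def
      uminus_bicomplex_def minus_bicomplex_def times_bicomplex_def)

text \<open>As a normed space the bicomplex numbers are identified with $\mathbb{C}^2 = \mathbb{R}^4$;
  this provides the topology, measurability and the Bochner integral.\<close>

instantiation bicomplex :: real_inner
begin

definition scaleR_bicomplex_def: "scaleR r u = Bicomplex (r *\<^sub>R bc_fst u) (r *\<^sub>R bc_snd u)"
definition inner_bicomplex_def: "inner u v = inner (bc_fst u) (bc_fst v) + inner (bc_snd u) (bc_snd v)"
definition norm_bicomplex_def: "norm (u::bicomplex) = sqrt (inner u u)"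
definition dist_bicomplex_def: "dist u v = norm (u - v :: bicomplex)"
definition sgn_bicomplex_def: "sgn u = inverse (norm u) *\<^sub>R (u::bicomplex)"
definition uniformity_bicomplex_def:
  "(uniformity :: (bicomplex \<times> bicomplex) filter)
    = (INF e\<in>{0 <..}. principal {(x, y). dist x y < e})"
definition open_bicomplex_def:
  "open (U :: bicomplex set) \<longleftrightarrow>
    (\<forall>x\<in>U. eventually (\<lambda>(x', y). x' = x \<longrightarrow> y \<in> U) uniformity)"

instance
proof
  fix r t :: real and u v w :: bicomplex
  show "r *\<^sub>R (u + v) = r *\<^sub>R u + r *\<^sub>R v"
    by (simp add: bicomplex_eq_iff scaleR_bicomplex_def scaleR_right_distrib)
  show "(r + t) *\<^sub>R u = r *\<^sub>R u + t *\<^sub>R u"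
    by (simp add: bicomplex_eq_iff scaleR_bicomplex_def scaleR_left_distrib)
  show "r *\<^sub>R t *\<^sub>R u = (r * t) *\<^sub>R u" "1 *\<^sub>R u = u"
    by (simp_all add: bicomplex_eq_iff scaleR_bicomplex_def)
  show "inner u v = inner v u"
    unfolding inner_bicomplex_def
    by (simp only: inner_commute[of "bc_fst u"] inner_commute[of "bc_snd u"])
  show "inner (u + v) w = inner u w + inner v w"
    by (simp add: inner_bicomplex_def inner_add_left)
  show "inner (r *\<^sub>R u) v = r * inner u v"
    by (simp add: inner_bicomplex_def scaleR_bicomplex_def distrib_left)
  show "0 \<le> inner u u"
    unfolding inner_bicomplex_def by (intro add_nonneg_nonneg inner_ge_zero)
  show "inner u u = 0 \<longleftrightarrow> u = 0"
    unfolding inner_bicomplex_def bicomplex_eq_iff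
    by (simp add: add_nonneg_eq_0_iff)
qed (simp_all only: norm_bicomplex_def dist_bicomplex_def sgn_bicomplex_def
      uniformity_bicomplex_def open_bicomplex_def)

end

lemma bicomplex_scaleR_sel [simp]:
  "bc_fst (r *\<^sub>R u) = r *\<^sub>R bc_fst u" "bc_snd (r *\<^sub>R u) = r *\<^sub>R bc_snd u"
  by (simp_all add: scaleR_bicomplex_def)

instance bicomplex :: real_algebra_1
proof
  fix r :: real and u v :: bicomplex
  show "r *\<^sub>R u * v = r *\<^sub>R (u * v)" "u * r *\<^sub>R v = r *\<^sub>R (u * v)"
    by (simp_all add: bicomplex_eq_iff scaleR_right_diff_distrib scaleR_right_distrib)
qed

instantiation bicomplex :: euclidean_space
begin

definition Basis_bicomplex_def:
  "Basis = (\<lambda>b. Bicomplex b 0) ` Basis \<union> (\<lambda>b. Bicomplex 0 b) ` Basis"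

instance
proof
  show "(Basis :: bicomplex set) \<noteq> {}" "finite (Basis :: bicomplex set)"
    by (simp_all add: Basis_bicomplex_def)
next
  fix u v :: bicomplex
  assume "u \<in> Basis" "v \<in> Basis"
  then show "inner u v = (if u = v then 1 else 0)"
    by (auto simp: Basis_bicomplex_def inner_bicomplex_def inner_Basis split: if_splits)
next
  fix u :: bicomplex
  show "(\<forall>b\<in>Basis. inner u b = 0) \<longleftrightarrow> u = 0"
    unfolding Basis_bicomplex_def ball_Un ball_simps inner_bicomplex_def bicomplex.sel
      inner_zero_right add_0_left add_0_right euclidean_all_zero_iff
    by (simp only: bicomplex_eq_iff bicomplex_sel)
qed

end

definition bc_j :: bicomplex where
  "bc_j = Bicomplex 0 1"

lemma bc_j_squared: "bc_j * bc_j = - 1"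
  by (simp add: bicomplex_eq_iff bc_j_def)

definition bc_conj :: "bicomplex \<Rightarrow> bicomplex" where
  "bc_conj u = Bicomplex (bc_fst u) (- bc_snd u)"

text \<open>The bicomplexification $\widehat u = x + j y$ of $u = x + i y$.\<close>

definition bc_hat :: "complex \<Rightarrow> bicomplex" where
  "bc_hat u = of_real (Re u) + bc_j * of_real (Im u)"

lemma bc_hat_plus_bc_hat_cnj: "bc_hat z + bc_hat (cnj z) = of_real (2 * Re z)"
proof -
  have "bc_hat z + bc_hat (cnj z) = of_real (Re z) + of_real (Re z)"
    by (simp add: bc_hat_def)
  then show ?thesis
    by simp
qed

section \<open>Test functions and weak derivatives\<close>

definition partial_x :: "(complex \<Rightarrow> real) \<Rightarrow> complex \<Rightarrow> real" where
  "partial_x \<phi> = (\<lambda>z. frechet_derivative \<phi> (at z) 1)"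

definition partial_y :: "(complex \<Rightarrow> real) \<Rightarrow> complex \<Rightarrow> real" where
  "partial_y \<phi> = (\<lambda>z. frechet_derivative \<phi> (at z) \<i>)"

text \<open>\<open>C_k k \<phi>\<close>: the function is of class $C^k$ on the plane.\<close>

primrec C_k :: "nat \<Rightarrow> (complex \<Rightarrow> real) \<Rightarrow> bool" where
  "C_k 0 \<phi> \<longleftrightarrow> continuous_on UNIV \<phi>"
| "C_k (Suc k) \<phi> \<longleftrightarrow>
     (\<forall>z. \<phi> differentiable (at z)) \<and> C_k k (partial_x \<phi>) \<and> C_k k (partial_y \<phi>)"

definition test_function :: "complex set \<Rightarrow> (complex \<Rightarrow> real) \<Rightarrow> bool" where
  "test_function D \<phi> \<longleftrightarrow>
     (\<forall>k. C_k k \<phi>) \<and> compact (closure {z. \<phi> z \<noteq> 0}) \<and> closure {z. \<phi> z \<noteq> 0} \<subseteq> D"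

definition locally_integrable_on ::
  "(complex \<Rightarrow> 'a::euclidean_space) \<Rightarrow> complex set \<Rightarrow> bool" (infix "locally'_integrable'_on" 46)
  where "f locally_integrable_on D \<longleftrightarrow>
     (\<forall>K. compact K \<and> K \<subseteq> D \<longrightarrow> f absolutely_integrable_on K)"

definition has_weak_partial ::
  "complex set \<Rightarrow> nat \<Rightarrow> nat \<Rightarrow> (complex \<Rightarrow> complex) \<Rightarrow> (complex \<Rightarrow> complex) \<Rightarrow> bool" where
  "has_weak_partial D a b u g \<longleftrightarrow>
     u locally_integrable_on D \<and> g locally_integrable_on D \<and>
     (\<forall>\<phi>. test_function D \<phi> \<longrightarrow>
        (LINT z|lebesgue_on D. (partial_x ^^ a) ((partial_y ^^ b) \<phi>) z *\<^sub>R u z) =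
        (- 1) ^ (a + b) *\<^sub>R (LINT z|lebesgue_on D. \<phi> z *\<^sub>R g z))"

definition in_Lq :: "complex set \<Rightarrow> real \<Rightarrow> (complex \<Rightarrow> complex) \<Rightarrow> bool" where
  "in_Lq D q u \<longleftrightarrow>
     u \<in> borel_measurable (lebesgue_on D) \<and> integrable (lebesgue_on D) (\<lambda>z. norm (u z) powr q)"

definition in_Sobolev :: "complex set \<Rightarrow> nat \<Rightarrow> real \<Rightarrow> (complex \<Rightarrow> complex) \<Rightarrow> bool" where
  "in_Sobolev D m q u \<longleftrightarrow>
     in_Lq D q u \<and> (\<forall>a b. a + b \<le> m \<longrightarrow> (\<exists>g. has_weak_partial D a b u g \<and> in_Lq D q g))"

definition in_Sobolev_bc :: "complex set \<Rightarrow> nat \<Rightarrow> real \<Rightarrow> (complex \<Rightarrow> bicomplex) \<Rightarrow> bool" where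
  "in_Sobolev_bc D m q A \<longleftrightarrow>
     in_Sobolev D m q (\<lambda>z. bc_fst (A z)) \<and> in_Sobolev D m q (\<lambda>z. bc_snd (A z))"

definition dbar_test :: "(complex \<Rightarrow> real) \<Rightarrow> complex \<Rightarrow> bicomplex" where
  "dbar_test \<phi> z = (1 / 2) *\<^sub>R (of_real (partial_x \<phi> z) + bc_j * of_real (partial_y \<phi> z))"

text \<open>\<open>has_weak_dbar D f h\<close>: the distributional derivative
  $\bar\partial f = \frac12(\partial_x + j\partial_y) f$ on $D$ is the locally integrable function
  \<open>h\<close>.  Real-valued test functions suffice, bicomplex-valued ones being
  bicomplex-linear combinations of them.\<close>

definition has_weak_dbar ::
  "complex set \<Rightarrow> (complex \<Rightarrow> bicomplex) \<Rightarrow> (complex \<Rightarrow> bicomplex) \<Rightarrow> bool" where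
  "has_weak_dbar D f h \<longleftrightarrow>
     f locally_integrable_on D \<and> h locally_integrable_on D \<and>
     (\<forall>\<phi>. test_function D \<phi> \<longrightarrow>
        (LINT z|lebesgue_on D. dbar_test \<phi> z * f z) = - (LINT z|lebesgue_on D. \<phi> z *\<^sub>R h z))"

section \<open>The function classes\<close>

definition H_class ::
  "complex set \<Rightarrow> (complex \<Rightarrow> bicomplex) \<Rightarrow> (complex \<Rightarrow> bicomplex) \<Rightarrow> (complex \<Rightarrow> bicomplex) set" where
  "H_class D A B = {f. has_weak_dbar D f (\<lambda>z. A z * f z + B z * bc_conj (f z))}"

text \<open>Weakly differentiated functions are determined only up to null sets, so
  $\bar\partial - A - B\,C(\cdot)$ is a relation: \<open>vekua_op D A B f g\<close> says that $(\bar\partial - A - B\,C(\cdot)) f$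
  is the locally integrable function \<open>g\<close> almost everywhere on \<open>D\<close>.\<close>

definition vekua_op ::
  "complex set \<Rightarrow> (complex \<Rightarrow> bicomplex) \<Rightarrow> (complex \<Rightarrow> bicomplex) \<Rightarrow>
   (complex \<Rightarrow> bicomplex) \<Rightarrow> (complex \<Rightarrow> bicomplex) \<Rightarrow> bool" where
  "vekua_op D A B f g \<longleftrightarrow>
     g locally_integrable_on D \<and>
     (\<exists>h. has_weak_dbar D f h \<and>
        (AE z in lebesgue_on D. g z = h z - A z * f z - B z * bc_conj (f z)))"

definition V_class ::
  "complex set \<Rightarrow> nat \<Rightarrow> (complex \<Rightarrow> bicomplex) \<Rightarrow> (complex \<Rightarrow> bicomplex) \<Rightarrow>
   (complex \<Rightarrow> bicomplex) set" where
  "V_class D n A B =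
     {f. \<exists>g. (vekua_op D A B ^^ n) f g \<and> (AE z in lebesgue_on D. g z = 0)}"

end

theory Submission
  imports Defs
begin

text \<open>
  Put $T = \bar\partial - A - B\,C(\cdot)$ and let $X = \widehat z + \widehat{z^*} = 2x$. As $X$ is
  real it commutes with multiplication by $A$ and with $B\,C(\cdot)$, and $\bar\partial X = 1$. Hence
  $[T, X] = 1$: the operators $T$ and $X$ satisfy the relation that differentiation and
  multiplication by the variable satisfy on functions of one variable, and solutions of
  $T^n f = 0$ behave like polynomials of degree less than $n$ in $X$ whose coefficients are
  annihilated by $T$. The coefficients are Taylor coefficients taken at $X = 0$,
  \[ \varphi_k = \frac{1}{k!} \sum_{j < n - k} \frac{(-X)^j}{j!}\, T^{k+j} f . \]
  By $T (X^j g) = j X^{j-1} g + X^j T g$ the sum $T \varphi_k$ telescopes to a power of $X$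
  times $T^n f$, up to a constant factor (\<open>vekua_op_taylor\<close>), and $\sum_k X^k \varphi_k = f$ holds at every point, because the coefficient of
  $T^m f$ in it is $(X - X)^m / m!$ (\<open>taylor_inversion\<close>).

  The only analytic ingredient is the Leibniz rule $\bar\partial (x u) = \frac12 u + x \bar\partial u$ for
  weak derivatives (\<open>has_weak_dbar_Re\<close>). It is proved by testing the equation for $u$ with
  $x \phi$, again a test function. Every $T^k f$ is locally integrable by definition, so its
  products with powers of $X$ are too, and the rest of the argument is algebra.
\<close>

section \<open>Test functions\<close>

lemma C_k_mono: "C_k (Suc k) \<phi> \<Longrightarrow> C_k k \<phi>"
proof (induction k arbitrary: \<phi>)
  case 0
  then show ?case
    by (auto intro!: continuous_at_imp_continuous_on differentiable_imp_continuous_within)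
next
  case (Suc k)
  show ?case
    using Suc.prems Suc.IH[of "partial_x \<phi>"] Suc.IH[of "partial_y \<phi>"] by (subst C_k.simps) simp
qed

lemma partial_add:
  assumes "\<phi> differentiable (at z)" "\<psi> differentiable (at z)"
  shows "partial_x (\<lambda>z. \<phi> z + \<psi> z) z = partial_x \<phi> z + partial_x \<psi> z"
    and "partial_y (\<lambda>z. \<phi> z + \<psi> z) z = partial_y \<phi> z + partial_y \<psi> z"
proof -
  have "((\<lambda>z. \<phi> z + \<psi> z) has_derivative
      (\<lambda>h. frechet_derivative \<phi> (at z) h + frechet_derivative \<psi> (at z) h)) (at z)"
    using assms unfolding frechet_derivative_works by (rule has_derivative_add)
  from fun_cong[OF frechet_derivative_at[OF this, symmetric]]
  show "partial_x (\<lambda>z. \<phi> z + \<psi> z) z = partial_x \<phi> z + partial_x \<psi> z"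
    and "partial_y (\<lambda>z. \<phi> z + \<psi> z) z = partial_y \<phi> z + partial_y \<psi> z"
    by (simp_all add: partial_x_def partial_y_def)
qed

lemma C_k_add: "C_k k \<phi> \<Longrightarrow> C_k k \<psi> \<Longrightarrow> C_k k (\<lambda>z. \<phi> z + \<psi> z)"
proof (induction k arbitrary: \<phi> \<psi>)
  case 0
  then show ?case by (auto intro: continuous_on_add)
next
  case (Suc k)
  have "partial_x (\<lambda>z. \<phi> z + \<psi> z) = (\<lambda>z. partial_x \<phi> z + partial_x \<psi> z)"
    "partial_y (\<lambda>z. \<phi> z + \<psi> z) = (\<lambda>z. partial_y \<phi> z + partial_y \<psi> z)"
    using Suc.prems by (auto simp: partial_add)
  with Suc show ?case by auto
qed

lemma partial_Re_mult:
  assumes "\<phi> differentiable (at z)"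
  shows "partial_x (\<lambda>z. Re z * \<phi> z) z = \<phi> z + Re z * partial_x \<phi> z"
    and "partial_y (\<lambda>z. Re z * \<phi> z) z = Re z * partial_y \<phi> z"
proof -
  have "((\<lambda>z. Re z * \<phi> z) has_derivative
      (\<lambda>h. Re z * frechet_derivative \<phi> (at z) h + Re h * \<phi> z)) (at z)"
    using assms unfolding frechet_derivative_works
    by (intro has_derivative_mult has_derivative_Re has_derivative_ident)
  from fun_cong[OF frechet_derivative_at[OF this, symmetric]]
  show "partial_x (\<lambda>z. Re z * \<phi> z) z = \<phi> z + Re z * partial_x \<phi> z"
    and "partial_y (\<lambda>z. Re z * \<phi> z) z = Re z * partial_y \<phi> z"
    by (simp_all add: partial_x_def partial_y_def)
qed

lemma C_k_Re_mult: "C_k k \<phi> \<Longrightarrow> C_k k (\<lambda>z. Re z * \<phi> z)"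
proof (induction k arbitrary: \<phi>)
  case 0
  then show ?case by (auto intro!: continuous_intros)
next
  case (Suc k)
  have eq: "partial_x (\<lambda>z. Re z * \<phi> z) = (\<lambda>z. \<phi> z + Re z * partial_x \<phi> z)"
    "partial_y (\<lambda>z. Re z * \<phi> z) = (\<lambda>z. Re z * partial_y \<phi> z)"
    using Suc.prems by (auto simp: partial_Re_mult)
  have "(\<lambda>z. Re z * \<phi> z) differentiable (at z)" for z
    using Suc.prems bounded_linear_imp_differentiable[OF bounded_linear_Re]
    by (simp add: differentiable_mult)
  with Suc show ?case
    unfolding C_k.simps eq by (auto intro!: C_k_add C_k_mono[of k \<phi>])
qed

lemma test_function_Re_mult:
  assumes "test_function D \<phi>"
  shows "test_function D (\<lambda>z. Re z * \<phi> z)"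
proof -
  have \<phi>: "C_k k \<phi>" "compact (closure {z. \<phi> z \<noteq> 0})" "closure {z. \<phi> z \<noteq> 0} \<subseteq> D" for k
    using assms by (simp_all add: test_function_def)
  have sub: "closure {z. Re z * \<phi> z \<noteq> 0} \<subseteq> closure {z. \<phi> z \<noteq> 0}"
    by (intro closure_mono) auto
  then have "compact (closure {z. Re z * \<phi> z \<noteq> 0})"
    using \<phi>(2) compact_Int_closed[OF \<phi>(2) closed_closure, of "{z. Re z * \<phi> z \<noteq> 0}"]
    by (simp add: inf.absorb2)
  with sub \<phi>(3) show ?thesis
    unfolding test_function_def using C_k_Re_mult[OF \<phi>(1)] by simp
qed

lemma test_function_differentiable: "test_function D \<phi> \<Longrightarrow> \<phi> differentiable (at z)"
  unfolding test_function_def by (metis C_k.simps(2))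

lemma test_function_continuous: "test_function D \<phi> \<Longrightarrow> continuous_on UNIV \<phi>"
  unfolding test_function_def by (metis C_k.simps(1))

lemma dbar_test_alt:
  "dbar_test \<phi> z = (partial_x \<phi> z / 2) *\<^sub>R 1 + (partial_y \<phi> z / 2) *\<^sub>R bc_j"
  by (simp add: dbar_test_def of_real_def scaleR_add_right)

lemma dbar_test_continuous:
  assumes "test_function D \<phi>"
  shows "continuous_on UNIV (dbar_test \<phi>)"
proof -
  have "continuous_on UNIV (partial_x \<phi>)" "continuous_on UNIV (partial_y \<phi>)"
    using assms unfolding test_function_def by (metis C_k.simps)+
  then have "continuous_on UNIV
      (\<lambda>z. (partial_x \<phi> z / 2) *\<^sub>R 1 + (partial_y \<phi> z / 2) *\<^sub>R bc_j)"
    by (auto intro!: continuous_intros)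
  then show ?thesis
    by (simp add: dbar_test_alt[abs_def])
qed

lemma dbar_test_eq_0:
  assumes "z \<notin> closure {z. \<phi> z \<noteq> 0}"
  shows "dbar_test \<phi> z = 0"
proof -
  have "(\<phi> has_derivative (\<lambda>_. 0)) (at z)"
  proof (rule has_derivative_transform_within_open)
    show "((\<lambda>_. 0) has_derivative (\<lambda>_. 0)) (at z)" by simp
    show "open (- closure {z. \<phi> z \<noteq> 0})" by auto
    show "z \<in> - closure {z. \<phi> z \<noteq> 0}" using assms by auto
    show "\<And>w. w \<in> - closure {z. \<phi> z \<noteq> 0} \<Longrightarrow> 0 = \<phi> w"
      using closure_subset[of "{z. \<phi> z \<noteq> 0}"] by auto
  qed
  from frechet_derivative_at[OF this, symmetric] show ?thesis
    by (simp add: dbar_test_def partial_x_def partial_y_def)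
qed

section \<open>Local integrability\<close>

lemma locally_integrable_on_bilinear:
  fixes w :: "complex \<Rightarrow> 'b::euclidean_space"
  assumes "f locally_integrable_on D" "continuous_on UNIV w" "bilinear h"
  shows "(\<lambda>z. h (w z) (f z)) locally_integrable_on D"
  unfolding locally_integrable_on_def
proof (intro allI impI)
  fix K assume K: "compact K \<and> K \<subseteq> D"
  then have K_sets: "K \<in> sets lebesgue"
    by (simp add: borel_compact)
  have w: "continuous_on K w"
    using assms(2) continuous_on_subset by blast
  show "(\<lambda>z. h (w z) (f z)) absolutely_integrable_on K"
  proof (rule absolutely_integrable_bounded_measurable_product[of h w K f])
    show "bilinear h" by fact
    show "w \<in> borel_measurable (lebesgue_on K)"
      using w K_sets by (rule continuous_imp_measurable_on_sets_lebesgue)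
    show "K \<in> sets lebesgue" by fact
    show "bounded (w ` K)"
      using w K by (simp add: compact_continuous_image compact_imp_bounded)
    show "f absolutely_integrable_on K"
      using assms(1) K by (auto simp: locally_integrable_on_def)
  qed
qed

lemma locally_integrable_on_scaleR:
  assumes "f locally_integrable_on D" "continuous_on UNIV (r :: complex \<Rightarrow> real)"
  shows "(\<lambda>z. r z *\<^sub>R f z) locally_integrable_on D"
  using assms
  by (rule locally_integrable_on_bilinear)
     (simp add: bilinear_conv_bounded_bilinear bounded_bilinear_scaleR)

lemma locally_integrable_on_add:
  "f locally_integrable_on D \<Longrightarrow> g locally_integrable_on D
    \<Longrightarrow> (\<lambda>z. f z + g z) locally_integrable_on D"
  by (auto simp: locally_integrable_on_def intro: set_integral_add)

lemma locally_integrable_on_cong_AE: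
  assumes "f locally_integrable_on D" "D \<in> sets lebesgue"
    and "AE z in lebesgue_on D. f z = g z"
  shows "g locally_integrable_on D"
  unfolding locally_integrable_on_def
proof (intro allI impI)
  fix K assume K: "compact K \<and> K \<subseteq> D"
  have "AE z in lebesgue. z \<in> D \<longrightarrow> f z = g z"
    using assms(2,3) by (simp add: AE_restrict_space_iff)
  then obtain N where "N \<in> null_sets lebesgue" "{z. \<not> (z \<in> D \<longrightarrow> f z = g z)} \<subseteq> N"
    by (auto simp: eventually_ae_filter)
  then have "negligible N" "\<And>z. z \<in> K - N \<Longrightarrow> g z = f z"
    using K by (auto simp: negligible_iff_null_sets)
  moreover have "f absolutely_integrable_on K"
    using assms(1) K by (auto simp: locally_integrable_on_def)
  ultimately show "g absolutely_integrable_on K"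
    by (rule absolutely_integrable_spike[rotated])
qed

lemma integrable_on_of_compact_support:
  fixes f :: "complex \<Rightarrow> 'a::euclidean_space"
  assumes "f locally_integrable_on D" "D \<in> sets lebesgue"
    and "compact K" "K \<subseteq> D" "\<And>z. z \<notin> K \<Longrightarrow> f z = 0"
  shows "integrable (lebesgue_on D) f"
proof -
  have "f absolutely_integrable_on K"
    using assms by (auto simp: locally_integrable_on_def)
  then have "integrable lebesgue (\<lambda>z. indicator K z *\<^sub>R f z)"
    by (simp add: set_integrable_def)
  also have "(\<lambda>z. indicator K z *\<^sub>R f z) = (\<lambda>z. indicator D z *\<^sub>R f z)"
  proof
    show "indicator K z *\<^sub>R f z = indicator D z *\<^sub>R f z" for z
      using assms(4) assms(5)[of z] by (cases "z \<in> K") (auto simp: subset_iff)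
  qed
  finally show ?thesis
    using assms(2) by (simp add: integrable_restrict_space)
qed

lemma integrable_test_scaleR:
  assumes "f locally_integrable_on D" "D \<in> sets lebesgue" "test_function D \<phi>"
  shows "integrable (lebesgue_on D) (\<lambda>z. \<phi> z *\<^sub>R f z)"
proof (rule integrable_on_of_compact_support)
  show "(\<lambda>z. \<phi> z *\<^sub>R f z) locally_integrable_on D"
    using assms test_function_continuous by (blast intro: locally_integrable_on_scaleR)
  show "compact (closure {z. \<phi> z \<noteq> 0})" "closure {z. \<phi> z \<noteq> 0} \<subseteq> D"
    using assms by (auto simp: test_function_def)
  show "\<phi> z *\<^sub>R f z = 0" if "z \<notin> closure {z. \<phi> z \<noteq> 0}" for z
    using that closure_subset[of "{z. \<phi> z \<noteq> 0}"] by auto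
qed fact

lemma integrable_dbar_test_mult:
  assumes "f locally_integrable_on D" "D \<in> sets lebesgue" "test_function D \<phi>"
  shows "integrable (lebesgue_on D) (\<lambda>z. dbar_test \<phi> z * f z)"
proof (rule integrable_on_of_compact_support)
  show "(\<lambda>z. dbar_test \<phi> z * f z) locally_integrable_on D"
    using assms(1) dbar_test_continuous[OF assms(3)] bilinear_times
    by (rule locally_integrable_on_bilinear)
  show "compact (closure {z. \<phi> z \<noteq> 0})" "closure {z. \<phi> z \<noteq> 0} \<subseteq> D"
    using assms by (auto simp: test_function_def)
  show "dbar_test \<phi> z * f z = 0" if "z \<notin> closure {z. \<phi> z \<noteq> 0}" for z
    using dbar_test_eq_0[OF that] by simp
qed fact

section \<open>The weak derivative\<close>

lemma has_weak_dbar_cong_AE: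
  assumes "has_weak_dbar D f h" "D \<in> sets lebesgue" "AE z in lebesgue_on D. h z = h' z"
  shows "has_weak_dbar D f h'"
proof -
  have h: "h locally_integrable_on D" and h': "h' locally_integrable_on D"
    using assms locally_integrable_on_cong_AE by (auto simp: has_weak_dbar_def)
  have "(LINT z|lebesgue_on D. \<phi> z *\<^sub>R h z) = (LINT z|lebesgue_on D. \<phi> z *\<^sub>R h' z)"
    if "test_function D \<phi>" for \<phi>
    using integrable_test_scaleR[OF h assms(2) that] integrable_test_scaleR[OF h' assms(2) that]
      assms(3)
    by (intro integral_cong_AE) auto
  with assms(1) h' show ?thesis
    by (auto simp: has_weak_dbar_def)
qed

lemma has_weak_dbar_add:
  assumes "has_weak_dbar D f h" "has_weak_dbar D f' h'" "D \<in> sets lebesgue"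
  shows "has_weak_dbar D (\<lambda>z. f z + f' z) (\<lambda>z. h z + h' z)"
proof -
  have li: "f locally_integrable_on D" "f' locally_integrable_on D"
    "h locally_integrable_on D" "h' locally_integrable_on D"
    using assms(1,2) by (auto simp: has_weak_dbar_def)
  have "(LINT z|lebesgue_on D. dbar_test \<phi> z * (f z + f' z))
      = - (LINT z|lebesgue_on D. \<phi> z *\<^sub>R (h z + h' z))" if \<phi>: "test_function D \<phi>" for \<phi>
  proof -
    note int = li[THEN integrable_dbar_test_mult, OF assms(3) \<phi>]
      li[THEN integrable_test_scaleR, OF assms(3) \<phi>]
    have "(LINT z|lebesgue_on D. dbar_test \<phi> z * f z) = - (LINT z|lebesgue_on D. \<phi> z *\<^sub>R h z)"
      "(LINT z|lebesgue_on D. dbar_test \<phi> z * f' z) = - (LINT z|lebesgue_on D. \<phi> z *\<^sub>R h' z)"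
      using assms(1,2) \<phi> by (simp_all add: has_weak_dbar_def)
    then show ?thesis
      unfolding distrib_left scaleR_add_right
        Bochner_Integration.integral_add[OF int(1,2)] Bochner_Integration.integral_add[OF int(7,8)]
      by simp
  qed
  with li show ?thesis
    unfolding has_weak_dbar_def by (auto intro: locally_integrable_on_add)
qed

lemma has_weak_dbar_scaleR:
  assumes "has_weak_dbar D f h"
  shows "has_weak_dbar D (\<lambda>z. c *\<^sub>R f z) (\<lambda>z. c *\<^sub>R h z)"
proof -
  have "dbar_test \<phi> z * (c *\<^sub>R f z) = c *\<^sub>R (dbar_test \<phi> z * f z)"
    "\<phi> z *\<^sub>R (c *\<^sub>R h z) = c *\<^sub>R (\<phi> z *\<^sub>R h z)" for \<phi> z
    by (simp_all add: mult.commute)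
  with assms show ?thesis
    unfolding has_weak_dbar_def
    by (simp add: locally_integrable_on_scaleR del: scaleR_scaleR)
qed

lemma dbar_test_Re_mult:
  assumes "test_function D \<phi>"
  shows "dbar_test (\<lambda>z. Re z * \<phi> z) z = (\<phi> z / 2) *\<^sub>R 1 + Re z *\<^sub>R dbar_test \<phi> z"
  using test_function_differentiable[OF assms, of z]
  by (simp add: dbar_test_alt partial_Re_mult add_divide_distrib scaleR_add_left
      scaleR_add_right add.assoc)

text \<open>The Leibniz rule, moved onto the test function: $x \phi$ is a test function with
  $\bar\partial (x \phi) = \frac12 \phi + x \bar\partial \phi$.\<close>

lemma has_weak_dbar_Re:
  assumes f: "has_weak_dbar D f h" and D: "D \<in> sets lebesgue"
  shows "has_weak_dbar D (\<lambda>z. Re z *\<^sub>R f z) (\<lambda>z. (1 / 2) *\<^sub>R f z + Re z *\<^sub>R h z)"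
proof -
  have li: "f locally_integrable_on D" "h locally_integrable_on D"
    using f by (auto simp: has_weak_dbar_def)
  have cont: "continuous_on UNIV Re"
    by (intro continuous_intros)
  have li_Re: "(\<lambda>z. Re z *\<^sub>R h z) locally_integrable_on D"
    "(\<lambda>z. Re z *\<^sub>R f z) locally_integrable_on D"
    "(\<lambda>z. (1 / 2) *\<^sub>R f z) locally_integrable_on D"
    using li cont by (auto intro!: locally_integrable_on_scaleR)
  have "(LINT z|lebesgue_on D. dbar_test \<phi> z * (Re z *\<^sub>R f z))
      = - (LINT z|lebesgue_on D. \<phi> z *\<^sub>R ((1 / 2) *\<^sub>R f z + Re z *\<^sub>R h z))"
    if \<phi>: "test_function D \<phi>" for \<phi>
  proof -
    note \<psi> = test_function_Re_mult[OF \<phi>]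
    note int = integrable_test_scaleR[OF li_Re(1) D \<phi>] integrable_test_scaleR[OF li_Re(3) D \<phi>]
      integrable_dbar_test_mult[OF li(1) D \<psi>]
    have "(LINT z|lebesgue_on D. dbar_test \<phi> z * (Re z *\<^sub>R f z))
        = (LINT z|lebesgue_on D. dbar_test (\<lambda>z. Re z * \<phi> z) z * f z - \<phi> z *\<^sub>R ((1 / 2) *\<^sub>R f z))"
      by (simp add: dbar_test_Re_mult[OF \<phi>] distrib_right)
    also have "\<dots> = (LINT z|lebesgue_on D. dbar_test (\<lambda>z. Re z * \<phi> z) z * f z)
        - (LINT z|lebesgue_on D. \<phi> z *\<^sub>R ((1 / 2) *\<^sub>R f z))"
      using int by (intro Bochner_Integration.integral_diff)
    also have "(LINT z|lebesgue_on D. dbar_test (\<lambda>z. Re z * \<phi> z) z * f z)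
        = - (LINT z|lebesgue_on D. (Re z * \<phi> z) *\<^sub>R h z)"
      using f \<psi> unfolding has_weak_dbar_def by blast
    also have "(\<lambda>z. (Re z * \<phi> z) *\<^sub>R h z) = (\<lambda>z. \<phi> z *\<^sub>R (Re z *\<^sub>R h z))"
      by (simp add: mult.commute)
    also have "- (LINT z|lebesgue_on D. \<phi> z *\<^sub>R (Re z *\<^sub>R h z))
          - (LINT z|lebesgue_on D. \<phi> z *\<^sub>R ((1 / 2) *\<^sub>R f z))
        = - (LINT z|lebesgue_on D. \<phi> z *\<^sub>R ((1 / 2) *\<^sub>R f z + Re z *\<^sub>R h z))"
      unfolding scaleR_add_right[of "\<phi> _"]
      by (subst Bochner_Integration.integral_add[OF int(2,1)]) simp
    finally show ?thesis .
  qed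
  with li_Re show ?thesis
    unfolding has_weak_dbar_def by (auto intro: locally_integrable_on_add)
qed

section \<open>The commutation relation for the Vekua operator\<close>

lemma bc_conj_add: "bc_conj (u + v) = bc_conj u + bc_conj v"
  and bc_conj_scaleR: "bc_conj (c *\<^sub>R u) = c *\<^sub>R bc_conj u"
  by (simp_all add: bc_conj_def bicomplex_eq_iff)

lemma vekua_op_add:
  assumes "vekua_op D A B f g" "vekua_op D A B f' g'" "D \<in> sets lebesgue"
  shows "vekua_op D A B (\<lambda>z. f z + f' z) (\<lambda>z. g z + g' z)"
proof -
  from assms obtain h h' where
    h: "has_weak_dbar D f h" "has_weak_dbar D f' h'" and
    ae: "AE z in lebesgue_on D. g z = h z - A z * f z - B z * bc_conj (f z)"
      "AE z in lebesgue_on D. g' z = h' z - A z * f' z - B z * bc_conj (f' z)"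
    by (auto simp: vekua_op_def)
  have "AE z in lebesgue_on D. g z + g' z
      = (h z + h' z) - A z * (f z + f' z) - B z * bc_conj (f z + f' z)"
    using ae by eventually_elim (simp (no_asm_simp) add: bc_conj_add algebra_simps)
  with has_weak_dbar_add[OF h assms(3)] assms(1,2) show ?thesis
    by (auto simp: vekua_op_def intro: locally_integrable_on_add)
qed

lemma vekua_op_scaleR:
  assumes "vekua_op D A B f g"
  shows "vekua_op D A B (\<lambda>z. c *\<^sub>R f z) (\<lambda>z. c *\<^sub>R g z)"
proof -
  from assms obtain h where h: "has_weak_dbar D f h" and
    ae: "AE z in lebesgue_on D. g z = h z - A z * f z - B z * bc_conj (f z)"
    by (auto simp: vekua_op_def)
  have "AE z in lebesgue_on D.
      c *\<^sub>R g z = c *\<^sub>R h z - A z * (c *\<^sub>R f z) - B z * bc_conj (c *\<^sub>R f z)"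
    using ae by eventually_elim (simp add: bc_conj_scaleR scaleR_diff_right)
  with has_weak_dbar_scaleR[OF h, of c] assms show ?thesis
    by (auto simp: vekua_op_def intro!: locally_integrable_on_scaleR)
qed

text \<open>This is $[T, 2x] = 1$. Conjugation does not interfere because $x$ is real.\<close>

lemma vekua_op_Re:
  assumes T: "vekua_op D A B f g" and D: "D \<in> sets lebesgue"
  shows "vekua_op D A B (\<lambda>z. (2 * Re z) *\<^sub>R f z) (\<lambda>z. f z + (2 * Re z) *\<^sub>R g z)"
proof -
  from T obtain h where h: "has_weak_dbar D f h" and
    ae: "AE z in lebesgue_on D. g z = h z - A z * f z - B z * bc_conj (f z)"
    by (auto simp: vekua_op_def)
  have dbar: "has_weak_dbar D (\<lambda>z. (2 * Re z) *\<^sub>R f z) (\<lambda>z. f z + (2 * Re z) *\<^sub>R h z)"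
    using has_weak_dbar_scaleR[OF has_weak_dbar_Re[OF h D], of 2]
    by (simp add: scaleR_add_right)
  have "AE z in lebesgue_on D. f z + (2 * Re z) *\<^sub>R g z
      = (f z + (2 * Re z) *\<^sub>R h z) - A z * ((2 * Re z) *\<^sub>R f z)
        - B z * bc_conj ((2 * Re z) *\<^sub>R f z)"
    using ae by eventually_elim (simp add: bc_conj_scaleR scaleR_diff_right del: scaleR_scaleR)
  moreover have "(\<lambda>z. f z + (2 * Re z) *\<^sub>R g z) locally_integrable_on D"
    using T h unfolding vekua_op_def has_weak_dbar_def
    by (intro locally_integrable_on_add locally_integrable_on_scaleR) (auto intro!: continuous_intros)
  ultimately show ?thesis
    using dbar by (auto simp: vekua_op_def)
qed

lemma vekua_op_Re_power:
  assumes "vekua_op D A B f g" and D: "D \<in> sets lebesgue"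
  shows "vekua_op D A B (\<lambda>z. (2 * Re z) ^ j *\<^sub>R f z)
    (\<lambda>z. (of_nat j * (2 * Re z) ^ (j - 1)) *\<^sub>R f z + (2 * Re z) ^ j *\<^sub>R g z)"
proof (induction j)
  case 0
  then show ?case using assms by simp
next
  case (Suc j)
  have eq: "(2 * Re z) ^ j *\<^sub>R f z + (2 * Re z) *\<^sub>R
        ((of_nat j * (2 * Re z) ^ (j - 1)) *\<^sub>R f z + (2 * Re z) ^ j *\<^sub>R g z)
      = (of_nat (Suc j) * (2 * Re z) ^ (Suc j - 1)) *\<^sub>R f z + (2 * Re z) ^ Suc j *\<^sub>R g z" for z
  proof -
    have "of_nat (Suc j) * (2 * Re z) ^ (Suc j - 1)
        = (2 * Re z) ^ j + 2 * Re z * (of_nat j * (2 * Re z) ^ (j - 1))"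
      by (cases j) (simp_all add: algebra_simps)
    then show ?thesis
      by (simp only: scaleR_add_left scaleR_add_right scaleR_scaleR power_Suc add.assoc)
  qed
  show ?case
    using vekua_op_Re[OF Suc.IH D] unfolding eq by (simp only: scaleR_scaleR power_Suc)
qed

text \<open>Applying $T$ to a Taylor sum leaves only the top term: the derivative of $(-X)^{j+1}/(j+1)!$
  cancels what $T$ makes of the preceding iterate.\<close>

lemma vekua_op_taylor:
  assumes "\<And>j. j \<le> m \<Longrightarrow> vekua_op D A B (G j) (G (Suc j))" and D: "D \<in> sets lebesgue"
  shows "vekua_op D A B (\<lambda>z. \<Sum>j\<le>m. ((- (2 * Re z)) ^ j / fact j) *\<^sub>R G j z)
    (\<lambda>z. ((- (2 * Re z)) ^ m / fact m) *\<^sub>R G (Suc m) z)"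
  using assms(1)
proof (induction m)
  case 0
  then show ?case by simp
next
  case (Suc m)
  define c :: real where "c = (- 1) ^ Suc m / fact (Suc m)"
  have c: "c * (of_nat (Suc m) * x ^ m) = - ((- x) ^ m / fact m)"
    "c * x ^ Suc m = (- x) ^ Suc m / fact (Suc m)" for x :: real
    unfolding c_def by (simp_all add: power_minus[of x] divide_simps del: of_nat_Suc)
  have "vekua_op D A B (\<lambda>z. \<Sum>j\<le>m. ((- (2 * Re z)) ^ j / fact j) *\<^sub>R G j z)
      (\<lambda>z. ((- (2 * Re z)) ^ m / fact m) *\<^sub>R G (Suc m) z)"
    using Suc by simp
  moreover have "vekua_op D A B (\<lambda>z. c *\<^sub>R ((2 * Re z) ^ Suc m *\<^sub>R G (Suc m) z))
      (\<lambda>z. c *\<^sub>R ((of_nat (Suc m) * (2 * Re z) ^ (Suc m - 1)) *\<^sub>R G (Suc m) z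
        + (2 * Re z) ^ Suc m *\<^sub>R G (Suc (Suc m)) z))"
    using Suc.prems D by (intro vekua_op_scaleR vekua_op_Re_power) auto
  ultimately have "vekua_op D A B
      (\<lambda>z. (\<Sum>j\<le>m. ((- (2 * Re z)) ^ j / fact j) *\<^sub>R G j z)
        + c *\<^sub>R ((2 * Re z) ^ Suc m *\<^sub>R G (Suc m) z))
      (\<lambda>z. ((- (2 * Re z)) ^ m / fact m) *\<^sub>R G (Suc m) z
        + c *\<^sub>R ((of_nat (Suc m) * (2 * Re z) ^ (Suc m - 1)) *\<^sub>R G (Suc m) z
          + (2 * Re z) ^ Suc m *\<^sub>R G (Suc (Suc m)) z))"
    using D by (rule vekua_op_add)
  then show ?case
    by (simp only: sum.atMost_Suc scaleR_add_right scaleR_scaleR diff_Suc_1 c scaleR_minus_left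
        add_minus_cancel)
qed

lemma H_class_of_vekua_op_null:
  assumes "vekua_op D A B f g" "AE z in lebesgue_on D. g z = 0" "D \<in> sets lebesgue"
  shows "f \<in> H_class D A B"
proof -
  from assms obtain h where h: "has_weak_dbar D f h" and
    ae: "AE z in lebesgue_on D. g z = h z - A z * f z - B z * bc_conj (f z)"
    by (auto simp: vekua_op_def)
  have "AE z in lebesgue_on D. h z = A z * f z + B z * bc_conj (f z)"
    using ae assms(2) by eventually_elim (simp add: algebra_simps)
  with has_weak_dbar_cong_AE[OF h assms(3)] show ?thesis
    by (simp add: H_class_def)
qed

section \<open>The decomposition\<close>

text \<open>Collecting the coefficient of \<open>G m\<close> gives $(x - x)^m / m!$ by the binomial theorem.\<close>

lemma taylor_inversion:
  fixes G :: "nat \<Rightarrow> 'a::real_vector" and x :: real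
  assumes "n \<ge> 1"
  shows "(\<Sum>k<n. (x ^ k / fact k) *\<^sub>R (\<Sum>j<n - k. ((- x) ^ j / fact j) *\<^sub>R G (k + j))) = G 0"
proof -
  let ?F = "\<lambda>k j. (x ^ k / fact k * ((- x) ^ j / fact j)) *\<^sub>R G (k + j)"
  have set_eq: "{(k, j). k + j < n} = Sigma {..<n} (\<lambda>k. {..<n - k})"
    by auto
  have binomial: "(\<Sum>k\<le>m. x ^ k / fact k * ((- x) ^ (m - k) / fact (m - k))) = (if m = 0 then 1 else 0)"
    for m
  proof -
    have "(\<Sum>k\<le>m. x ^ k / fact k * ((- x) ^ (m - k) / fact (m - k)))
        = (\<Sum>k\<le>m. (x ^ k /\<^sub>R fact k) * ((- x) ^ (m - k) /\<^sub>R fact (m - k)))"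
      by (simp add: divide_inverse mult.commute)
    also have "\<dots> = (x + - x) ^ m /\<^sub>R fact m"
      by (rule exp_series_add_commuting[symmetric]) simp
    finally show ?thesis
      by (simp add: power_0_left)
  qed
  have "(\<Sum>k<n. (x ^ k / fact k) *\<^sub>R (\<Sum>j<n - k. ((- x) ^ j / fact j) *\<^sub>R G (k + j)))
      = (\<Sum>k<n. \<Sum>j<n - k. ?F k j)"
    by (simp add: scaleR_sum_right)
  also have "\<dots> = (\<Sum>(k, j) \<in> {(k, j). k + j < n}. ?F k j)"
    unfolding set_eq by (rule sum.Sigma) auto
  also have "\<dots> = (\<Sum>m<n. \<Sum>k\<le>m. ?F k (m - k))"
    by (rule sum.triangle_reindex)
  also have "\<dots> = (\<Sum>m<n. (\<Sum>k\<le>m. x ^ k / fact k * ((- x) ^ (m - k) / fact (m - k))) *\<^sub>R G m)"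
    by (simp add: scaleR_sum_left)
  also have "\<dots> = (\<Sum>m<n. if m = 0 then G 0 else 0)"
    unfolding binomial by (intro sum.cong) auto
  also have "\<dots> = G 0"
    using assms by simp
  finally show ?thesis .
qed

theorem theorem6p8:
  fixes n :: nat and q :: real
    and A B f :: "complex \<Rightarrow> bicomplex"
  assumes "n \<ge> 1" and "q > 2"
    and "in_Sobolev_bc (ball 0 1) (n - 1) q A"
    and "in_Sobolev_bc (ball 0 1) (n - 1) q B"
    and "f \<in> V_class (ball 0 1) n A B"
  shows "\<exists>\<phi> :: nat \<Rightarrow> complex \<Rightarrow> bicomplex.
           (\<forall>k<n. \<phi> k \<in> H_class (ball 0 1) A B) \<and>
           (\<forall>z\<in>ball 0 1. f z = (\<Sum>k<n. (bc_hat z + bc_hat (cnj z)) ^ k * \<phi> k z))"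
proof -
  let ?D = "ball 0 1 :: complex set"
  have D: "?D \<in> sets lebesgue"
    by simp
  \<comment> \<open>\<open>G k\<close> is a version of the iterate $T^k f$, with \<open>G 0 = f\<close> exactly; this is why the
    decomposition holds at every point of the disk and not only almost everywhere.\<close>
  from assms(5) obtain G where G0: "G 0 = f"
    and G: "\<And>k. k < n \<Longrightarrow> vekua_op ?D A B (G k) (G (Suc k))"
    and Gn: "AE z in lebesgue_on ?D. G n z = 0"
    by (auto simp: V_class_def relpowp_fun_conv)
  define \<phi> where "\<phi> k z =
    (1 / fact k) *\<^sub>R (\<Sum>j<n - k. ((- (2 * Re z)) ^ j / fact j) *\<^sub>R G (k + j) z)" for k z
  have "\<phi> k \<in> H_class ?D A B" if k: "k < n" for k
  proof -
    from k obtain m where m: "n = Suc (k + m)"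
      using less_imp_Suc_add by blast
    have "vekua_op ?D A B (\<lambda>z. \<Sum>j\<le>m. ((- (2 * Re z)) ^ j / fact j) *\<^sub>R G (k + j) z)
        (\<lambda>z. ((- (2 * Re z)) ^ m / fact m) *\<^sub>R G (k + Suc m) z)"
      using vekua_op_taylor[of m ?D A B "\<lambda>j. G (k + j)"] G m D by simp
    from vekua_op_scaleR[OF this, of "1 / fact k"]
    have "vekua_op ?D A B (\<phi> k)
        (\<lambda>z. (1 / fact k) *\<^sub>R (((- (2 * Re z)) ^ m / fact m) *\<^sub>R G (k + Suc m) z))"
      by (simp add: \<phi>_def[abs_def] m Suc_diff_le lessThan_Suc_atMost)
    moreover have "AE z in lebesgue_on ?D.
        (1 / fact k) *\<^sub>R (((- (2 * Re z)) ^ m / fact m) *\<^sub>R G (k + Suc m) z) = 0"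
      using Gn by eventually_elim (simp add: m)
    ultimately show ?thesis
      using D by (rule H_class_of_vekua_op_null)
  qed
  moreover have "f z = (\<Sum>k<n. (bc_hat z + bc_hat (cnj z)) ^ k * \<phi> k z)" for z
  proof -
    have "(bc_hat z + bc_hat (cnj z)) ^ k = (2 * Re z) ^ k *\<^sub>R 1" for k
      unfolding bc_hat_plus_bc_hat_cnj of_real_power[symmetric] by (simp only: of_real_def)
    then have "(\<Sum>k<n. (bc_hat z + bc_hat (cnj z)) ^ k * \<phi> k z)
        = (\<Sum>k<n. ((2 * Re z) ^ k / fact k) *\<^sub>R
            (\<Sum>j<n - k. ((- (2 * Re z)) ^ j / fact j) *\<^sub>R G (k + j) z))"
      by (simp add: \<phi>_def)
    also have "\<dots> = f z"
      using taylor_inversion[OF assms(1), of "2 * Re z" "\<lambda>k. G k z"] by (simp add: G0)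
    finally show ?thesis by simp
  qed
  ultimately show ?thesis
    by blast
qed

end
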